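(* Let $U\subsetneq\mathbb{C}$ be a simply connected domain containing the origin. If the Skorokhod energy $\Lambda(U)$ is finite, then $U$ has finite perimeter and finite area, i.e. $\ell(U)<\infty$ and $\mathrm{area}(U)<\infty$.
   Context: $\mathbb{D}$ is the open unit disc; "univalent" means analytic and injective. Let $f(z)=\sum_{n\ge1}c_nz^n$ be any univalent function mapping $\mathbb{D}$ onto $U$ with $f(0)=0$. The Skorokhod energy of $U$ is $\Lambda(U)=\mathfrak{E}(\Re f(e^{ti}))=\frac14\sum_{n=1}^{\infty}n^2|c_n|^2\in[0,+\infty]$, where for a real $2\pi$-periodic $h$, $\mathfrak{E}(h)=\frac12\cdot\frac{1}{2\pi}\int_0^{2\pi}|h'(t)|^2dt$ with $h'$ the distributional derivative; the coefficient formula is taken as its meaning in all cases, and it does not depend on the choice of $f$. The perimeter of $U$ (also for non-smooth boundaries) is $\ell(U)=2\pi H_1(f')$, where for $g$ analytic in $\mathbb{D}$, $H_1(g)=\sup_{0\le r<1}\frac{1}{2\pi}\int_0^{2\pi}|g(re^{\theta i})|\,d\theta$. The area of $U$ is its two-dimensional Lebesgue measure. *)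

theory Defs
  imports "HOL-Complex_Analysis.Complex_Analysis"
begin

definition riemann_map :: "complex set \<Rightarrow> (complex \<Rightarrow> complex) \<Rightarrow> bool" where
  "riemann_map U f \<longleftrightarrow>
     f holomorphic_on ball 0 1 \<and> inj_on f (ball 0 1) \<and> f ` ball 0 1 = U \<and> f 0 = 0"

definition taylor_coeff :: "(complex \<Rightarrow> complex) \<Rightarrow> nat \<Rightarrow> complex" where
  "taylor_coeff f n = (deriv ^^ n) f 0 / fact n"

(* Half the mean square over a period of the derivative of t |-> Re f (exp (i t)), expressed by
   Parseval through the Taylor coefficients of f; the coefficient formula is the definition.
   The n = 0 term vanishes, so this is the sum over n >= 1; in ennreal the sum always exists. *)
definition boundary_energy :: "(complex \<Rightarrow> complex) \<Rightarrow> ennreal" where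
  "boundary_energy f = ennreal (1/4) * (\<Sum>n. ennreal ((real n)\<^sup>2 * (norm (taylor_coeff f n))\<^sup>2))"

definition hardy_norm1 :: "(complex \<Rightarrow> complex) \<Rightarrow> ennreal" where
  "hardy_norm1 g = (SUP r\<in>{0..<1}.
     ennreal (1 / (2*pi)) * (\<integral>\<^sup>+\<theta>\<in>{0..2*pi}. ennreal (norm (g (of_real r * exp (\<i> * of_real \<theta>)))) \<partial>lborel))"

(* The choice of the map is immaterial: see riemann_map_exists, skorokhod_energy_eq
   and perimeter_eq below. *)
definition skorokhod_energy :: "complex set \<Rightarrow> ennreal" where
  "skorokhod_energy U = boundary_energy (SOME f. riemann_map U f)"

definition perimeter :: "complex set \<Rightarrow> ennreal" where
  "perimeter U = ennreal (2*pi) * hardy_norm1 (deriv (SOME f. riemann_map U f))"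


lemma riemann_map_exists:
  assumes "open U" "simply_connected U" "0 \<in> U" "U \<noteq> UNIV"
  shows "\<exists>f. riemann_map U f"
proof -
  obtain f g where f: "f holomorphic_on U" and g: "g holomorphic_on ball 0 1"
    and fg: "\<And>z. z \<in> U \<Longrightarrow> f z \<in> ball 0 1 \<and> g (f z) = z"
    and gf: "\<And>z. z \<in> ball 0 1 \<Longrightarrow> g z \<in> U \<and> f (g z) = z"
    using assms simply_connected_eq_biholomorphic_to_disc[OF \<open>open U\<close>] by (metis empty_iff)
  have "f 0 \<in> ball 0 1" using fg assms by blast
  then obtain h k where h: "h (f 0) = 0" "h holomorphic_on ball 0 1" "h ` ball 0 1 \<subseteq> ball 0 1"
    and k: "k holomorphic_on ball 0 1" "k ` ball 0 1 \<subseteq> ball 0 1"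
    and hk: "\<And>z. z \<in> ball 0 1 \<Longrightarrow> h (k z) = z" and kh: "\<And>z. z \<in> ball 0 1 \<Longrightarrow> k (h z) = z"
    by (rule ball_biholomorphism_exists) blast
  have "riemann_map U (g \<circ> k)"
    unfolding riemann_map_def
  proof (intro conjI)
    show "g \<circ> k holomorphic_on ball 0 1"
      using g k holomorphic_on_compose_gen by blast
    show "inj_on (g \<circ> k) (ball 0 1)"
      by (rule inj_on_inverseI[where g = "h \<circ> f"]) (use gf hk k(2) in force)
    show "(g \<circ> k) ` ball 0 1 = U"
    proof
      show "(g \<circ> k) ` ball 0 1 \<subseteq> U" using gf k(2) by force
      show "U \<subseteq> (g \<circ> k) ` ball 0 1"
      proof
        fix z assume z: "z \<in> U"
        have "h (f z) \<in> ball 0 1"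
          using fg[OF z] h(3) by blast
        moreover have "(g \<circ> k) (h (f z)) = z"
          using fg[OF z] kh by simp
        ultimately show "z \<in> (g \<circ> k) ` ball 0 1" by (metis imageI)
      qed
    qed
    show "(g \<circ> k) 0 = 0"
      using kh[OF \<open>f 0 \<in> ball 0 1\<close>] h(1) fg[OF \<open>0 \<in> U\<close>] by simp
  qed
  then show ?thesis by blast
qed

lemma riemann_map_schwarz:
  assumes f: "riemann_map U f" and g: "riemann_map U g"
  obtains p where "p holomorphic_on ball 0 1" "p 0 = 0" "\<And>z. norm z < 1 \<Longrightarrow> norm (p z) < 1"
    "\<And>z. norm z < 1 \<Longrightarrow> f (p z) = g z" "\<And>z. norm z < 1 \<Longrightarrow> norm (p z) \<le> norm z"
proof -
  have fh: "f holomorphic_on ball 0 1" and fi: "inj_on f (ball 0 1)"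
    and fU: "f ` ball 0 1 = U" and f0: "f 0 = 0"
    using f by (auto simp: riemann_map_def)
  have gh: "g holomorphic_on ball 0 1" and gU: "g ` ball 0 1 = U" and g0: "g 0 = 0"
    using g by (auto simp: riemann_map_def)
  obtain q where q: "q holomorphic_on f ` ball 0 1"
    and qf: "\<And>z. z \<in> ball 0 1 \<Longrightarrow> deriv f z * deriv q (f z) = 1"
            "\<And>z. z \<in> ball 0 1 \<Longrightarrow> q (f z) = z"
    using holomorphic_has_inverse[OF fh open_ball fi] by metis
  define p where "p = q \<circ> g"
  have h: "p holomorphic_on ball 0 1"
    unfolding p_def using q gh gU fU holomorphic_on_compose_gen by (metis order_refl)
  have p0: "p 0 = 0" using qf(2)[of 0] f0 g0 by (simp add: p_def)
  have *: "norm (p z) < 1 \<and> f (p z) = g z" if "norm z < 1" for z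
  proof -
    have "g z \<in> f ` ball 0 1" using that gU fU by auto
    then obtain w where "w \<in> ball 0 1" "g z = f w" by auto
    then show ?thesis using qf(2)[of w] by (simp add: p_def)
  qed
  show ?thesis
    by (rule that[of p]) (use h p0 * Schwarz_Lemma(1)[OF h p0] in auto)
qed

lemma riemann_map_unique:
  assumes f: "riemann_map U f" and g: "riemann_map U g"
  obtains c where "norm c = 1" "\<And>z. norm z < 1 \<Longrightarrow> g z = f (c * z)"
proof -
  obtain p where p: "p holomorphic_on ball 0 1" "p 0 = 0" "\<And>z. norm z < 1 \<Longrightarrow> norm (p z) < 1"
    "\<And>z. norm z < 1 \<Longrightarrow> f (p z) = g z" "\<And>z. norm z < 1 \<Longrightarrow> norm (p z) \<le> norm z"
    using riemann_map_schwarz[OF f g] by metis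
  obtain q where q: "\<And>z. norm z < 1 \<Longrightarrow> norm (q z) < 1"
    "\<And>z. norm z < 1 \<Longrightarrow> g (q z) = f z" "\<And>z. norm z < 1 \<Longrightarrow> norm (q z) \<le> norm z"
    using riemann_map_schwarz[OF g f] by metis
  define w :: complex where "w = 1/2"
  have w: "norm w < 1" "w \<noteq> 0" by (auto simp: w_def)
  have "g (q (p w)) = g w" using p q w by auto
  moreover have "q (p w) \<in> ball 0 1" "w \<in> ball 0 1" using p q w by auto
  ultimately have "q (p w) = w" using g unfolding riemann_map_def by (meson inj_onD)
  then have "norm (p w) = norm w" using p q w by (metis order_antisym)
  then obtain c where c: "\<And>z. norm z < 1 \<Longrightarrow> p z = c * z" "norm c = 1"
    using Schwarz_Lemma(3)[OF p(1,2,3), of 0] w by auto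
  then show ?thesis using p(4) that by metis
qed

lemma boundary_energy_rotate:
  assumes f: "f holomorphic_on ball 0 1" and c: "norm c = 1"
    and g: "\<And>z. norm z < 1 \<Longrightarrow> g z = f (c * z)"
  shows "boundary_energy g = boundary_energy f"
proof -
  have "(deriv ^^ n) g 0 = c ^ n * (deriv ^^ n) f 0" for n
  proof -
    have "eventually (\<lambda>z. z \<in> ball 0 1) (nhds (0::complex))"
      by (intro eventually_nhds_in_open) auto
    then have "eventually (\<lambda>z. g z = f (c * z)) (nhds 0)"
      by eventually_elim (use g in auto)
    then have "(deriv ^^ n) g 0 = (deriv ^^ n) (\<lambda>z. f (c * z)) 0"
      by (rule higher_deriv_cong_ev) simp
    also have "\<dots> = c ^ n * (deriv ^^ n) f (c * 0)"
      by (rule higher_deriv_compose_linear[OF f, of "ball 0 1"]) (auto simp: norm_mult c)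
    finally show ?thesis by simp
  qed
  then show ?thesis
    by (simp add: boundary_energy_def taylor_coeff_def norm_mult norm_divide norm_power c)
qed

lemma nn_integral_periodic_shift:
  fixes F :: "real \<Rightarrow> ennreal"
  assumes [measurable]: "F \<in> borel_measurable borel" and per: "\<And>x. F (x + 2*pi) = F x"
    and s: "0 \<le> s" "s < 2*pi"
  shows "(\<integral>\<^sup>+x\<in>{0..2*pi}. F (x + s) \<partial>lborel) = (\<integral>\<^sup>+x\<in>{0..2*pi}. F x \<partial>lborel)"
proof -
  have shift: "(\<integral>\<^sup>+x. G x \<partial>lborel) = (\<integral>\<^sup>+x. G (x + t) \<partial>lborel)"
    if [measurable]: "G \<in> borel_measurable borel" for G :: "real \<Rightarrow> ennreal" and t
    using nn_integral_real_affine[of G 1 t] by (simp add: add.commute)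
  have drop: "(\<integral>\<^sup>+x\<in>{0..2*pi}. G x \<partial>lborel) = (\<integral>\<^sup>+x\<in>{0..<2*pi}. G x \<partial>lborel)"
    for G :: "real \<Rightarrow> ennreal"
    by (intro nn_integral_cong_AE)
       (use AE_lborel_singleton[of "2*pi"] in eventually_elim, auto split: split_indicator)
  have "(\<integral>\<^sup>+x\<in>{0..<2*pi}. F (x + s) \<partial>lborel) = (\<integral>\<^sup>+x. F x * indicator {s..<s+2*pi} x \<partial>lborel)"
    by (subst shift[of "\<lambda>x. F x * indicator {s..<s+2*pi} x" s])
       (auto intro!: nn_integral_cong split: split_indicator)
  also have "\<dots> = (\<integral>\<^sup>+x. F x * indicator {s..<2*pi} x + F x * indicator {2*pi..<s+2*pi} x \<partial>lborel)"
    by (intro nn_integral_cong) (use s in \<open>auto split: split_indicator\<close>)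
  also have "\<dots> = (\<integral>\<^sup>+x. F x * indicator {s..<2*pi} x \<partial>lborel) + (\<integral>\<^sup>+x. F x * indicator {2*pi..<s+2*pi} x \<partial>lborel)"
    by (intro nn_integral_add) auto
  also have "(\<integral>\<^sup>+x. F x * indicator {2*pi..<s+2*pi} x \<partial>lborel) = (\<integral>\<^sup>+x. F x * indicator {0..<s} x \<partial>lborel)"
    by (subst shift[of "\<lambda>x. F x * indicator {2*pi..<s+2*pi} x" "2*pi"])
       (auto intro!: nn_integral_cong simp: per split: split_indicator)
  also have "(\<integral>\<^sup>+x. F x * indicator {s..<2*pi} x \<partial>lborel) + \<dots> =
      (\<integral>\<^sup>+x. F x * indicator {s..<2*pi} x + F x * indicator {0..<s} x \<partial>lborel)"
    by (intro nn_integral_add[symmetric]) auto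
  also have "\<dots> = (\<integral>\<^sup>+x\<in>{0..<2*pi}. F x \<partial>lborel)"
    by (intro nn_integral_cong) (use s in \<open>auto split: split_indicator\<close>)
  finally show ?thesis using drop by simp
qed

lemma hardy_norm1_rotate:
  assumes g: "continuous_on (ball 0 1) g" and c: "norm c = 1"
    and h: "\<And>z. norm z < 1 \<Longrightarrow> norm (h z) = norm (g (c * z))"
  shows "hardy_norm1 h = hardy_norm1 g"
proof -
  obtain s where s: "0 \<le> s" "s < 2*pi" "c = exp (\<i> * of_real s)"
    using complex_norm_eq_1_exp[of c] c by (metis Arg2pi Arg2pi_eq mult_1 of_real_1)
  have "(\<integral>\<^sup>+\<theta>\<in>{0..2*pi}. ennreal (norm (h (of_real r * exp (\<i> * of_real \<theta>)))) \<partial>lborel) =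
        (\<integral>\<^sup>+\<theta>\<in>{0..2*pi}. ennreal (norm (g (of_real r * exp (\<i> * of_real \<theta>)))) \<partial>lborel)"
    if r: "r \<in> {0..<1}" for r
  proof -
    define F where "F = (\<lambda>\<theta>. ennreal (norm (g (of_real r * exp (\<i> * of_real \<theta>)))))"
    have "continuous_on UNIV (\<lambda>\<theta>::real. norm (g (of_real r * exp (\<i> * of_real \<theta>))))"
      by (intro continuous_on_norm continuous_on_compose2[OF g] continuous_intros)
         (use r in \<open>auto simp: norm_mult\<close>)
    then have F: "F \<in> borel_measurable borel"
      unfolding F_def by (intro measurable_compose[OF _ measurable_ennreal] borel_measurable_continuous_onI)
    have per: "F (x + 2*pi) = F x" for x
      by (simp add: F_def exp_add distrib_left mult.assoc flip: exp_two_pi_i')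
         (simp add: mult_ac exp_two_pi_i')
    have "ennreal (norm (h (of_real r * exp (\<i> * of_real \<theta>)))) = F (\<theta> + s)" for \<theta>
      using r by (simp add: h F_def s(3) exp_add distrib_left mult_ac norm_mult)
    then show ?thesis
      using nn_integral_periodic_shift[OF F per s(1,2)] by (simp add: F_def)
  qed
  then show ?thesis unfolding hardy_norm1_def by (intro SUP_cong) auto
qed

lemma skorokhod_energy_eq:
  assumes "riemann_map U f"
  shows "skorokhod_energy U = boundary_energy f"
proof -
  have "riemann_map U (SOME f. riemann_map U f)" using someI[of "riemann_map U", OF assms] .
  then obtain c where "norm c = 1" "\<And>z. norm z < 1 \<Longrightarrow> (SOME f. riemann_map U f) z = f (c * z)"
    using riemann_map_unique[OF assms] by metis
  then show ?thesis unfolding skorokhod_energy_def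
    using assms boundary_energy_rotate unfolding riemann_map_def by blast
qed

lemma perimeter_eq:
  assumes "riemann_map U f"
  shows "perimeter U = ennreal (2*pi) * hardy_norm1 (deriv f)"
proof -
  define g where "g = (SOME f. riemann_map U f)"
  have "riemann_map U g" unfolding g_def using someI[of "riemann_map U", OF assms] .
  then obtain c where c: "norm c = 1" "\<And>z. norm z < 1 \<Longrightarrow> g z = f (c * z)"
    using riemann_map_unique[OF assms] by metis
  have f: "f holomorphic_on ball 0 1" using assms by (simp add: riemann_map_def)
  have "norm (deriv g z) = norm (deriv f (c * z))" if z: "norm z < 1" for z
  proof -
    have "eventually (\<lambda>w. w \<in> ball 0 1) (nhds z)"
      by (intro eventually_nhds_in_open) (use z in auto)
    then have "eventually (\<lambda>w. g w = f (c * w)) (nhds z)"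
      by eventually_elim (use c in auto)
    then have "deriv g z = deriv (\<lambda>w. f (c * w)) z"
      by (rule deriv_cong_ev) simp
    also have "\<dots> = c * deriv f (c * z)"
      using higher_deriv_compose_linear[OF f, of "ball 0 1" z c 1] z c(1)
      by (simp add: norm_mult)
    finally show ?thesis by (simp add: norm_mult c)
  qed
  moreover have "continuous_on (ball 0 1) (deriv f)"
    using f by (intro holomorphic_on_imp_continuous_on holomorphic_deriv) auto
  ultimately have "hardy_norm1 (deriv g) = hardy_norm1 (deriv f)"
    using c(1) by (intro hardy_norm1_rotate[of _ c])
  then show ?thesis by (simp add: perimeter_def g_def)
qed

end

theory Submission
  imports Defs
begin

text \<open>
  Finite energy says that the derivative of the Riemann map lies in the Hardy space of exponent 2,
  hence in that of exponent 1. It also makes the Taylor coefficients absolutely summable, by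
  comparison with the sum of the inverse squares, so the domain is bounded.
\<close>

text \<open>Orthogonality of the characters of the circle. The frequency \<open>k\<close> is an
  integer because it will be a difference of two exponents, which may be negative.\<close>

lemma has_integral_exp_int_period:
  fixes k :: int
  shows "((\<lambda>\<theta>::real. exp (\<i> * of_int k * of_real \<theta>)) has_integral (if k = 0 then of_real (2*pi) else 0)) {0..2*pi}"
proof (cases "k = 0")
  case True
  have "((\<lambda>\<theta>::real. 1::complex) has_integral (2*pi - 0) *\<^sub>R 1) {0..2*pi}"
    using has_integral_const_real[of "1::complex" 0 "2*pi"] by simp
  then show ?thesis using True by (simp add: scaleR_conv_of_real)
next
  case False
  let ?F = "\<lambda>\<theta>::real. exp (\<i> * of_int k * of_real \<theta>) / (\<i> * of_int k)"
  have "((\<lambda>\<theta>::real. exp (\<i> * of_int k * of_real \<theta>)) has_integral (?F (2*pi) - ?F 0)) {0..2*pi}"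
  proof (rule fundamental_theorem_of_calculus)
    fix x :: real assume "x \<in> {0..2*pi}"
    have "((\<lambda>z. exp (\<i> * of_int k * z) / (\<i> * of_int k)) has_field_derivative
        exp (\<i> * of_int k * of_real x)) (at (of_real x))"
      using False by (auto intro!: derivative_eq_intros)
    then show "(?F has_vector_derivative exp (\<i> * of_int k * of_real x)) (at x within {0..2*pi})"
      by (rule has_vector_derivative_real_field)
  qed simp
  \<comment> \<open>By periodicity the antiderivative takes the same value at both endpoints, so the
    integral vanishes.\<close>
  moreover have "exp (\<i> * of_int k * of_real (2*pi)) = 1"
    using exp_integer_2pi[of "of_int k"] by (simp add: mult_ac)
  ultimately show ?thesis using False by simp
qed

text \<open>Parseval for polynomials: the squared modulus is the sum times its conjugate, and
  orthogonality leaves only the diagonal of the resulting double sum. Other radii are covered by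
  absorbing the powers of the radius into \<open>b\<close>.\<close>

lemma has_integral_norm_trig_polynomial_square:
  fixes b :: "nat \<Rightarrow> complex"
  shows "((\<lambda>\<theta>::real. (norm (\<Sum>n<N. b n * exp (\<i> * of_real \<theta>) ^ n))\<^sup>2) has_integral
     2 * pi * (\<Sum>n<N. (norm (b n))\<^sup>2)) {0..2*pi}"
proof -
  let ?e = "\<lambda>k \<theta>::real. exp (\<i> * of_int k * of_real \<theta>)"
  let ?S = "\<lambda>\<theta>::real. \<Sum>n<N. b n * exp (\<i> * of_real \<theta>) ^ n"
  have expand: "complex_of_real ((norm (?S \<theta>))\<^sup>2) =
      (\<Sum>m<N. \<Sum>n<N. b m * cnj (b n) * ?e (int m - int n) \<theta>)" for \<theta>
  proof -
    have "complex_of_real ((norm (?S \<theta>))\<^sup>2) = ?S \<theta> * cnj (?S \<theta>)"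
      by (rule complex_norm_square)
    also have "\<dots> = (\<Sum>m<N. \<Sum>n<N. (b m * exp (\<i> * of_real \<theta>) ^ m) * cnj (b n * exp (\<i> * of_real \<theta>) ^ n))"
      unfolding cnj_sum by (rule sum_product)
    also have "\<dots> = (\<Sum>m<N. \<Sum>n<N. b m * cnj (b n) * ?e (int m - int n) \<theta>)"
    proof (intro sum.cong refl)
      fix m n
      \<comment> \<open>Conjugating \<open>exp (\<i> * of_real \<theta>) ^ n\<close> negates its
        frequency, so the product of the two powers has frequency m - n.\<close>
      have "?e (int m - int n) \<theta> = exp (of_nat m * (\<i> * of_real \<theta>) + of_nat n * (- (\<i> * of_real \<theta>)))"
        by (simp add: algebra_simps)
      also have "\<dots> = exp (\<i> * of_real \<theta>) ^ m * cnj (exp (\<i> * of_real \<theta>) ^ n)"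
        by (simp only: exp_add exp_of_nat_mult complex_cnj_power exp_cnj complex_cnj_mult
            complex_cnj_i complex_cnj_complex_of_real mult_minus_left)
      finally show "(b m * exp (\<i> * of_real \<theta>) ^ m) * cnj (b n * exp (\<i> * of_real \<theta>) ^ n) =
          b m * cnj (b n) * ?e (int m - int n) \<theta>"
        by simp
    qed
    finally show ?thesis .
  qed
  \<comment> \<open>The off-diagonal terms are not real, so the integration is done in the complex
    numbers and the real part is taken at the end.\<close>
  have "((\<lambda>\<theta>. complex_of_real ((norm (?S \<theta>))\<^sup>2)) has_integral
     (\<Sum>m<N. \<Sum>n<N. b m * cnj (b n) * (if int m - int n = 0 then of_real (2*pi) else 0))) {0..2*pi}"
    unfolding expand
    by (intro has_integral_sum has_integral_mult_right has_integral_exp_int_period finite_lessThan)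
  also have "(\<Sum>m<N. \<Sum>n<N. b m * cnj (b n) * (if int m - int n = 0 then of_real (2*pi) else 0)) =
      (\<Sum>m<N. \<Sum>n<N. if m = n then of_real (2 * pi * (norm (b m))\<^sup>2) else 0)"
    by (intro sum.cong refl) (simp add: complex_norm_square[unfolded of_real_power])
  also have "\<dots> = of_real (2 * pi * (\<Sum>n<N. (norm (b n))\<^sup>2))"
    by (simp add: sum_distrib_left)
  finally have "((\<lambda>\<theta>. complex_of_real ((norm (?S \<theta>))\<^sup>2)) has_integral
      of_real (2 * pi * (\<Sum>n<N. (norm (b n))\<^sup>2))) {0..2*pi}" .
  from has_integral_linear[OF this bounded_linear_Re] show ?thesis
    by (simp only: o_def Re_complex_of_real)
qed

text \<open>Parseval is applied to the partial sums only, and Fatou's lemma carries the upper bound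
  over to the limit. The bound is free of \<open>r\<close>, so it survives the supremum over radii
  in the Hardy norm.\<close>

lemma nn_integral_power_series_circle_le:
  fixes a :: "nat \<Rightarrow> complex"
  assumes sums: "\<And>z. norm z < 1 \<Longrightarrow> (\<lambda>n. a n * z ^ n) sums g z" and r: "0 \<le> r" "r < 1"
  shows "(\<integral>\<^sup>+\<theta>\<in>{0..2*pi}. ennreal ((norm (g (of_real r * exp (\<i> * of_real \<theta>))))\<^sup>2) \<partial>lborel)
    \<le> ennreal (2*pi) * (\<Sum>n. ennreal ((norm (a n))\<^sup>2))"
proof -
  define S where "S N \<theta> = (\<Sum>n<N. a n * of_real r ^ n * exp (\<i> * of_real \<theta>) ^ n)" for N and \<theta> :: real
  have lim: "(\<lambda>N. ennreal ((norm (S N \<theta>))\<^sup>2) * indicator {0..2*pi} \<theta>) \<longlonglongrightarrow>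
      ennreal ((norm (g (of_real r * exp (\<i> * of_real \<theta>))))\<^sup>2) * indicator {0..2*pi} \<theta>" for \<theta>
  proof -
    have "(\<lambda>N. S N \<theta>) \<longlonglongrightarrow> g (of_real r * exp (\<i> * of_real \<theta>))"
      using sums[of "of_real r * exp (\<i> * of_real \<theta>)"] r
      by (simp add: sums_def S_def norm_mult power_mult_distrib mult.assoc)
    then have "(\<lambda>N. ennreal ((norm (S N \<theta>))\<^sup>2)) \<longlonglongrightarrow> ennreal ((norm (g (of_real r * exp (\<i> * of_real \<theta>))))\<^sup>2)"
      by (intro tendsto_ennrealI tendsto_intros)
    then show ?thesis by (auto split: split_indicator)
  qed
  have meas: "(\<lambda>\<theta>. ennreal ((norm (S N \<theta>))\<^sup>2) * indicator {0..2*pi} \<theta>) \<in> borel_measurable lborel" for N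
    unfolding S_def by (intro borel_measurable_times_ennreal borel_measurable_indicator
        measurable_compose[OF _ measurable_ennreal]) (auto intro!: borel_measurable_continuous_onI continuous_intros)
  have le: "(\<integral>\<^sup>+\<theta>\<in>{0..2*pi}. ennreal ((norm (S N \<theta>))\<^sup>2) \<partial>lborel) \<le> ennreal (2*pi) * (\<Sum>n. ennreal ((norm (a n))\<^sup>2))" for N
  proof -
    have "(\<integral>\<^sup>+\<theta>\<in>{0..2*pi}. ennreal ((norm (S N \<theta>))\<^sup>2) \<partial>lborel) = ennreal (2 * pi * (\<Sum>n<N. (norm (a n * of_real r ^ n))\<^sup>2))"
      using has_integral_norm_trig_polynomial_square[where N = N and b = "\<lambda>n. a n * of_real r ^ n"]
      by (intro nn_integral_has_integral_lebesgue') (auto simp: S_def)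
    \<comment> \<open>Dropping the factors r^n, which are at most 1, makes the estimate uniform in
      \<open>r\<close>.\<close>
    also have "\<dots> \<le> ennreal (2 * pi * (\<Sum>n<N. (norm (a n))\<^sup>2))"
    proof -
      have "norm (a n * of_real r ^ n) \<le> norm (a n)" for n
        using r mult_left_le[of "r ^ n" "norm (a n)"] by (simp add: norm_mult norm_power power_le_one)
      then show ?thesis by (intro ennreal_leI mult_left_mono sum_mono power_mono) auto
    qed
    also have "\<dots> = ennreal (2*pi) * (\<Sum>n<N. ennreal ((norm (a n))\<^sup>2))"
      by (simp add: ennreal_mult sum_nonneg)
    also have "\<dots> \<le> ennreal (2*pi) * (\<Sum>n. ennreal ((norm (a n))\<^sup>2))"
      by (intro mult_left_mono sum_le_suminf) auto
    finally show ?thesis .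
  qed
  \<comment> \<open>Pointwise convergence makes the integrand a \<open>liminf\<close>, the form that
    Fatou's lemma needs.\<close>
  have "(\<integral>\<^sup>+\<theta>\<in>{0..2*pi}. ennreal ((norm (g (of_real r * exp (\<i> * of_real \<theta>))))\<^sup>2) \<partial>lborel) =
      (\<integral>\<^sup>+\<theta>. liminf (\<lambda>N. ennreal ((norm (S N \<theta>))\<^sup>2) * indicator {0..2*pi} \<theta>) \<partial>lborel)"
    using lim_imp_Liminf[OF _ lim] by simp
  also have "\<dots> \<le> liminf (\<lambda>N. \<integral>\<^sup>+\<theta>\<in>{0..2*pi}. ennreal ((norm (S N \<theta>))\<^sup>2) \<partial>lborel)"
    by (intro nn_integral_liminf meas)
  also have "\<dots> \<le> ennreal (2*pi) * (\<Sum>n. ennreal ((norm (a n))\<^sup>2))"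
    by (rule Liminf_le) (use le in auto)
  finally show ?thesis .
qed

lemma taylor_coeff_sums:
  assumes "f holomorphic_on ball 0 1" "norm z < 1"
  shows "(\<lambda>n. taylor_coeff f n * z ^ n) sums f z"
  using holomorphic_power_series[OF assms(1), of z] assms(2) by (simp add: taylor_coeff_def)

text \<open>The factor is the quotient of (n+1)! by n!. It accounts for the weights n^2 in the
  energy.\<close>

lemma taylor_coeff_deriv: "taylor_coeff (deriv f) n = of_nat (Suc n) * taylor_coeff f (Suc n)"
  by (simp add: taylor_coeff_def funpow_Suc_right del: funpow.simps of_nat_Suc)

text \<open>Up to a constant, the energy is the sum of the squared moduli of the coefficients of
  \<open>deriv f\<close>, which bounds its mean squares on all circles. Since only finiteness
  matters, the pointwise bound x \<le> 1 + x^2 takes the place of Cauchy-Schwarz.\<close>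

lemma hardy_norm1_deriv_finite:
  assumes f: "f holomorphic_on ball 0 1" and E: "boundary_energy f < \<infinity>"
  shows "hardy_norm1 (deriv f) < \<infinity>"
proof -
  define A where "A = (\<Sum>n. ennreal ((real n)\<^sup>2 * (norm (taylor_coeff f n))\<^sup>2))"
  define B where "B = (\<Sum>n. ennreal ((norm (taylor_coeff (deriv f) n))\<^sup>2))"
  have "A < \<infinity>"
    using E by (auto simp: boundary_energy_def A_def ennreal_mult_less_top)
  \<comment> \<open>The index shift loses only the term n = 0 of \<open>A\<close>, which is zero
    because of its weight.\<close>
  have "B = A"
    unfolding A_def B_def
    by (subst suminf_offset[of "\<lambda>n. ennreal ((real n)\<^sup>2 * (norm (taylor_coeff f n))\<^sup>2)" 1])
       (simp_all add: taylor_coeff_deriv norm_mult power_mult_distrib del: of_nat_Suc)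
  have df: "deriv f holomorphic_on ball 0 1"
    using f by (intro holomorphic_deriv) auto
  have "(\<integral>\<^sup>+\<theta>\<in>{0..2*pi}. ennreal (norm (deriv f (of_real r * exp (\<i> * of_real \<theta>)))) \<partial>lborel)
      \<le> ennreal (2*pi) + ennreal (2*pi) * B" if r: "r \<in> {0..<1}" for r
  proof -
    let ?g = "\<lambda>\<theta>. deriv f (of_real r * exp (\<i> * of_real \<theta>))"
    have "continuous_on UNIV (\<lambda>\<theta>::real. (norm (?g \<theta>))\<^sup>2)"
      by (intro continuous_on_power continuous_on_norm
            continuous_on_compose2[OF holomorphic_on_imp_continuous_on[OF df]] continuous_intros)
         (use r in \<open>auto simp: norm_mult\<close>)
    then have [measurable]: "(\<lambda>\<theta>. ennreal ((norm (?g \<theta>))\<^sup>2)) \<in> borel_measurable borel"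
      by (intro measurable_compose[OF _ measurable_ennreal] borel_measurable_continuous_onI)
    \<comment> \<open>Expanding the square of x - 1/2 even gives x \<le> x^2 + 1/4.\<close>
    have "x \<le> 1 + x\<^sup>2" for x :: real
      using zero_le_power2[of "x - 1/2"] by (simp add: power2_eq_square algebra_simps)
    then have "ennreal (norm w) \<le> 1 + ennreal ((norm w)\<^sup>2)" for w :: complex
      by (metis ennreal_1 ennreal_leI ennreal_plus zero_le_one zero_le_power2)
    then have "(\<integral>\<^sup>+\<theta>\<in>{0..2*pi}. ennreal (norm (?g \<theta>)) \<partial>lborel) \<le>
       (\<integral>\<^sup>+\<theta>. indicator {0..2*pi} \<theta> + ennreal ((norm (?g \<theta>))\<^sup>2) * indicator {0..2*pi} \<theta> \<partial>lborel)"
      by (intro nn_integral_mono) (auto split: split_indicator)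
    also have "\<dots> = ennreal (2*pi) + (\<integral>\<^sup>+\<theta>\<in>{0..2*pi}. ennreal ((norm (?g \<theta>))\<^sup>2) \<partial>lborel)"
      by (subst nn_integral_add) auto
    also have "\<dots> \<le> ennreal (2*pi) + ennreal (2*pi) * B"
      using r unfolding B_def
      by (intro add_left_mono nn_integral_power_series_circle_le taylor_coeff_sums df) auto
    finally show ?thesis .
  qed
  then have "hardy_norm1 (deriv f) \<le> ennreal (1 / (2*pi)) * (ennreal (2*pi) + ennreal (2*pi) * B)"
    unfolding hardy_norm1_def by (intro SUP_least mult_left_mono) auto
  also have "\<dots> < \<infinity>"
    using \<open>A < \<infinity>\<close> \<open>B = A\<close> by (simp add: ennreal_mult_less_top)
  finally show ?thesis .
qed

text \<open>The inequality of arithmetic and geometric means, applied to 1/n^2 and n^2 |c_n|^2,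
  bounds 2 |c_n| by the sum of two summable terms. An absolutely summable coefficient sequence
  bounds the power series on the whole disc.\<close>

lemma bounded_image_disc_if_boundary_energy_finite:
  assumes f: "f holomorphic_on ball 0 1" and E: "boundary_energy f < \<infinity>"
  shows "bounded (f ` ball 0 1)"
proof -
  let ?c = "taylor_coeff f"
  have "(\<Sum>n. ennreal ((real n)\<^sup>2 * (norm (?c n))\<^sup>2)) < \<infinity>"
    using E by (auto simp: boundary_energy_def ennreal_mult_less_top)
  then have sq: "summable (\<lambda>n. (real n)\<^sup>2 * (norm (?c n))\<^sup>2)"
    by (intro summable_suminf_not_top) auto
  have "summable (\<lambda>n. inverse ((real n)\<^sup>2) + (real n)\<^sup>2 * (norm (?c n))\<^sup>2)"
    by (intro summable_add sq inverse_power_summable) auto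
  \<comment> \<open>At n = 0 the right-hand side is 0, since \<open>inverse 0 = 0\<close>, while
    \<open>f 0\<close> is arbitrary here; hence the comparison starts at 1.\<close>
  moreover have "norm (?c n) \<le> inverse ((real n)\<^sup>2) + (real n)\<^sup>2 * (norm (?c n))\<^sup>2" if "n \<ge> 1" for n
  proof -
    have "0 \<le> (inverse (real n) - real n * norm (?c n))\<^sup>2" by simp
    also have "\<dots> = inverse ((real n)\<^sup>2) + (real n)\<^sup>2 * (norm (?c n))\<^sup>2 - 2 * norm (?c n)"
      using that by (simp add: power2_eq_square field_simps)
    finally show ?thesis using norm_ge_zero[of "?c n"] by linarith
  qed
  ultimately have c: "summable (\<lambda>n. norm (?c n))"
    by (intro summable_comparison_test[where f = "\<lambda>n. norm (?c n)"]) (auto intro!: exI[of _ 1])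
  have "norm (f z) \<le> (\<Sum>n. norm (?c n))" if z: "norm z < 1" for z
  proof -
    have le: "norm (?c n * z ^ n) \<le> norm (?c n)" for n
      using z mult_left_le[of "norm z ^ n" "norm (?c n)"] by (simp add: norm_mult norm_power power_le_one)
    have "f z = (\<Sum>n. ?c n * z ^ n)"
      using taylor_coeff_sums[OF f z] by (simp add: sums_iff)
    also have "norm \<dots> \<le> (\<Sum>n. norm (?c n))"
      by (intro norm_suminf_le le c)
    finally show ?thesis .
  qed
  then show ?thesis by (intro boundedI[where B = "\<Sum>n. norm (?c n)"]) auto
qed

theorem proposition4:
  fixes U :: "complex set"
  assumes "open U" and "connected U" and "simply_connected U"
    and "0 \<in> U" and "U \<noteq> UNIV"
    and "skorokhod_energy U < \<infinity>"
  shows "perimeter U < \<infinity> \<and> emeasure lebesgue U < \<infinity>"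
proof -
  obtain f where R: "riemann_map U f"
    using riemann_map_exists assms by blast
  then have f: "f holomorphic_on ball 0 1" and U: "f ` ball 0 1 = U"
    by (auto simp: riemann_map_def)
  \<comment> \<open>Independence of the choice of Riemann map lets the obtained \<open>f\<close>
    replace the one picked by \<open>SOME\<close>.\<close>
  have E: "boundary_energy f < \<infinity>"
    using assms skorokhod_energy_eq[OF R] by simp
  have "perimeter U < \<infinity>"
    using hardy_norm1_deriv_finite[OF f E] by (simp add: perimeter_eq[OF R] ennreal_mult_less_top)
  \<comment> \<open>An open set is Borel, so its \<open>lebesgue\<close> measure agrees with its
    \<open>lborel\<close> measure, which is finite on bounded sets.\<close>
  moreover have "emeasure lebesgue U < \<infinity>"
    using bounded_image_disc_if_boundary_energy_finite[OF f E] U \<open>open U\<close> emeasure_bounded_finite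
    by simp
  ultimately show ?thesis ..
qed

end
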